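(* Let $n\ge 1$, let $A$ be an $n\times n$ matrix over $\mathbb{C}$, let $I$ be the $n\times n$ identity matrix, and let $\lambda\in\mathbb{C}$ be an eigenvalue of $A$. Let $P(t)=\det(A-tI)$ be the characteristic polynomial of $A$. Assume that the geometric multiplicity of $\lambda$ equals $k$, where $1\le k\le n-1$. Then the following are equivalent: (i) The algebraic multiplicity of $\lambda$ equals $k$. (ii) There exist $k$-vectors $\mathbf{v}\in\bigwedge^k\ker(A-\lambda I)$ and $\mathbf{w}\in\bigwedge^k\ker(A-\lambda I)^{\top}$, regarded as column vectors in $\mathbb{C}^{\binom nk}$, such that $$\frac{(-1)^kP^{(k)}(\lambda)}{k!}\,\mathbf{v}\mathbf{w}^{\top}=\mathrm{adj}_k(A-\lambda I),$$ where $\mathrm{adj}_k(A-\lambda I)$ is the $k$th adjugate matrix of $A-\lambda I$.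
   Context: The geometric multiplicity of $\lambda$ is $\dim\ker(A-\lambda I)$; the algebraic multiplicity is the multiplicity of $\lambda$ as a root of $P$. $P^{(k)}$ is the $k$th derivative of $P$. The transpose is the plain transpose (no complex conjugation). $k$-element subsets of $\{1,\dots,n\}$ are ordered lexicographically (as increasing sequences) and index the coordinates of $\mathbb{C}^{\binom nk}\simeq\bigwedge^k\mathbb{C}^n$. For $\mathbf{x}_1,\dots,\mathbf{x}_k\in\mathbb{C}^n$, the wedge $\mathbf{x}_1\wedge\cdots\wedge\mathbf{x}_k$ is the vector in $\mathbb{C}^{\binom nk}$ whose $S$-coordinate, for $S=\{i_1<\dots<i_k\}$, is the $k\times k$ minor (determinant) of the $n\times k$ matrix $[\mathbf{x}_1\cdots\mathbf{x}_k]$ formed by the rows in $S$. For a subspace $W\subset\mathbb{C}^n$, $\bigwedge^kW\subset\mathbb{C}^{\binom nk}$ is the span of all $\mathbf{x}_1\wedge\cdots\wedge\mathbf{x}_k$ with $\mathbf{x}_1,\dots,\mathbf{x}_k\in W$. For an $n\times n$ matrix $B$ and $1\le k\le n-1$, the $k$th adjugate $\mathrm{adj}_k B$ is the $\binom nk\times\binom nk$ matrix whose entry in row $S=\{i_1<\dots<i_k\}$ and column $T=\{j_1<\dots<j_k\}$ is $(-1)^{\sum_{l=1}^k(i_l+j_l)}$ times the $(n-k)\times(n-k)$ minor (determinant) of $B$ obtained by deleting the rows $j_1,\dots,j_k$ and the columns $i_1,\dots,i_k$. In particular $\mathrm{adj}_1B$ is the classical adjugate. *)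

theory Defs
  imports
    "Jordan_Normal_Form.Char_Poly"
    "Jordan_Normal_Form.Matrix_Kernel"
    "Jordan_Normal_Form.DL_Submatrix"
begin

text \<open>Rows and columns of matrices are indexed from 0, so the index set of the rows of an
  n by n matrix is \<open>{..<n}\<close>.\<close>

text \<open>\<open>subseqs\<close> lists the subsequences containing the head before those that do not, so its
  members of length k come in lexicographic order; see \<open>ksubsets_lex\<close>.\<close>

definition ksubsets :: "nat \<Rightarrow> nat \<Rightarrow> nat set list" where
  "ksubsets n k = map set (filter (\<lambda>xs. length xs = k) (subseqs [0..<n]))"

lemma subseqs_sorted_wrt:
  "xs \<in> set (subseqs ys) \<Longrightarrow> sorted_wrt P ys \<Longrightarrow> sorted_wrt P xs"
proof (induction ys arbitrary: xs)
  case (Cons y ys)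
  have sub: "set zs \<subseteq> set ys" if "zs \<in> set (subseqs ys)" for zs
    using that subseqs_powset[of ys] by blast
  have "\<forall>z\<in>set zs. P y z" if "zs \<in> set (subseqs ys)" for zs
    using sub[OF that] Cons.prems(2) by auto
  with Cons show ?case by (auto simp: Let_def)
qed simp

lemma subseqs_lex:
  fixes ys :: "nat list"
  shows "sorted_wrt (<) ys \<Longrightarrow>
    sorted_wrt (\<lambda>xs xs'. (xs, xs') \<in> lexord less_than)
      (filter (\<lambda>xs. length xs = k) (subseqs ys))"
proof (induction ys arbitrary: k)
  case (Cons y ys)
  have lt: "y < z" if "z # zs \<in> set (subseqs ys)" for z zs
  proof -
    have "set (z # zs) \<subseteq> set ys" using that subseqs_powset[of ys] by blast
    then show ?thesis using Cons.prems by auto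
  qed
  show ?case
  proof (cases k)
    case 0
    have *: "filter (\<lambda>xs. xs = []) (map ((#) y) zss) = []" for zss
      by (induction zss) auto
    show ?thesis using Cons.IH[of 0] Cons.prems 0 by (simp add: Let_def *)
  next
    case (Suc m)
    have "(y # zs, zs') \<in> lexord less_than"
      if "zs' \<in> set (subseqs ys)" "length zs' = k" for zs zs'
    proof -
      obtain z us where z: "zs' = z # us" using \<open>length zs' = k\<close> Suc by (cases zs') auto
      then have "y < z" using that lt by metis
      then show ?thesis by (simp add: z)
    qed
    moreover have "sorted_wrt (\<lambda>xs xs'. (xs, xs') \<in> lexord less_than)
        (map ((#) y) (filter (\<lambda>xs. length xs = m) (subseqs ys)))"
      using Cons by (auto simp: sorted_wrt_map intro!: sorted_wrt_mono_rel[of _ "\<lambda>xs xs'. (xs, xs') \<in> lexord less_than"])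
    ultimately show ?thesis
      using Cons Suc by (auto simp: Let_def sorted_wrt_append filter_map o_def)
  qed
qed simp

lemma ksubsets_lex:
  "sorted_wrt (\<lambda>S T. (sorted_list_of_set S, sorted_list_of_set T) \<in> lexord less_than)
     (ksubsets n k)"
proof -
  have "sorted_list_of_set (set xs) = xs" if "xs \<in> set (subseqs [0..<n])" for xs
  proof -
    have "sorted_wrt (<) xs" using that by (rule subseqs_sorted_wrt) simp
    then show ?thesis by (simp add: sorted_list_of_set.idem_if_sorted_distinct strict_sorted_iff)
  qed
  then show ?thesis
    unfolding ksubsets_def sorted_wrt_map
    by (intro sorted_wrt_mono_rel[OF _ subseqs_lex]) auto
qed

lemma set_ksubsets: "set (ksubsets n k) = {S. S \<subseteq> {..<n} \<and> card S = k}"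
proof -
  have d: "distinct xs" if "xs \<in> set (subseqs [0..<n])" for xs
    using subseqs_distinctD[OF that] by simp
  have "S \<in> set (ksubsets n k)" if "S \<subseteq> {..<n}" "card S = k" for S
  proof -
    obtain xs where "xs \<in> set (subseqs [0..<n])" "S = set xs"
      using \<open>S \<subseteq> {..<n}\<close> subset_subseqs[of S "[0..<n]"] by (auto simp: lessThan_atLeast0)
    then show ?thesis using d that unfolding ksubsets_def
      by (auto simp: distinct_card)
  qed
  moreover have "S \<subseteq> {..<n} \<and> card S = k" if S: "S \<in> set (ksubsets n k)" for S
  proof -
    obtain xs where xs: "xs \<in> set (subseqs [0..<n])" "S = set xs" "length xs = k"
      using S unfolding ksubsets_def by auto
    then have "set xs \<subseteq> set [0..<n]" using subseqs_powset[of "[0..<n]"] by blast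
    then show ?thesis using xs d by (auto simp: distinct_card)
  qed
  ultimately show ?thesis by blast
qed

lemma distinct_ksubsets: "distinct (ksubsets n k)"
  using distinct_set_subseqs[of "[0..<n]"] unfolding ksubsets_def
  by (auto simp: distinct_map intro: inj_on_subset)

lemma length_ksubsets: "length (ksubsets n k) = n choose k"
  using distinct_card[OF distinct_ksubsets[of n k]] n_subsets[of "{..<n}" k]
  by (simp add: set_ksubsets)

definition wedge :: "nat \<Rightarrow> 'a :: comm_ring_1 vec list \<Rightarrow> 'a vec" where
  "wedge n xs = vec (n choose length xs)
     (\<lambda>i. det (submatrix (mat_of_cols n xs) (ksubsets n (length xs) ! i) UNIV))"

definition ext_power :: "nat \<Rightarrow> nat \<Rightarrow> 'a :: field vec set \<Rightarrow> 'a vec set" where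
  "ext_power n k W =
     LinearCombinations.module.span class_ring (module_vec TYPE('a) (n choose k))
       {wedge n xs | xs. length xs = k \<and> set xs \<subseteq> W}"

text \<open>\<open>Suc\<close> turns the 0-based indices into the usual 1-based ones in the sign.\<close>

definition adjugate_k :: "nat \<Rightarrow> 'a :: comm_ring_1 mat \<Rightarrow> 'a mat" where
  "adjugate_k k B =
     (let n = dim_row B in
      mat (n choose k) (n choose k)
       (\<lambda>(a, b). let S = ksubsets n k ! a; T = ksubsets n k ! b in
          (-1) ^ ((\<Sum>i\<in>S. Suc i) + (\<Sum>j\<in>T. Suc j)) *
          det (submatrix B ({..<n} - T) ({..<n} - S))))"

text \<open>The library's \<open>char_poly\<close> is \<open>det (t I - A)\<close>; this is \<open>det (A - t I)\<close>, which differs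
  from it by the factor \<open>(-1) ^ n\<close>.\<close>

definition det_char_poly :: "'a :: comm_ring_1 mat \<Rightarrow> 'a poly" where
  "det_char_poly A = det (map_mat (\<lambda>a. [:a:]) A - [:0, 1:] \<cdot>\<^sub>m 1\<^sub>m (dim_row A))"

definition algebraic_multiplicity :: "'a :: idom mat \<Rightarrow> 'a \<Rightarrow> nat" where
  "algebraic_multiplicity A \<mu> = Polynomial.order \<mu> (det_char_poly A)"

definition geometric_multiplicity :: "'a :: field mat \<Rightarrow> 'a \<Rightarrow> nat" where
  "geometric_multiplicity A \<mu> = kernel_dim (A - \<mu> \<cdot>\<^sub>m 1\<^sub>m (dim_row A))"

definition outer_product :: "'a :: comm_ring_1 vec \<Rightarrow> 'a vec \<Rightarrow> 'a mat" where
  "outer_product v w =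
     mat_of_cols (dim_vec v) [v] * transpose_mat (mat_of_cols (dim_vec w) [w])"

lemma poly_det_char_poly:
  fixes A :: "'a :: comm_ring_1 mat"
  assumes A: "A \<in> carrier_mat n n"
  shows "poly (det_char_poly A) t = det (A - t \<cdot>\<^sub>m 1\<^sub>m n)"
proof -
  have ev: "comm_ring_hom (\<lambda>p :: 'a poly. poly p t)"
    by unfold_locales auto
  have "map_mat (\<lambda>p. poly p t) (map_mat (\<lambda>a. [:a:]) A - [:0, 1:] \<cdot>\<^sub>m 1\<^sub>m n)
      = A - t \<cdot>\<^sub>m 1\<^sub>m n"
    using A by (intro eq_matI) auto
  then show ?thesis
    using A unfolding det_char_poly_def by (metis carrier_matD(1) comm_ring_hom.hom_det[OF ev])
qed

end

theory Submission
  imports Defs "Jordan_Normal_Form.DL_Rank"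
begin

text \<open>Put \<open>B = A - \<mu> I\<close>. As the kernel of \<open>B\<close> has dimension \<open>k\<close>, there are invertible \<open>U\<close>, \<open>V\<close>
  with \<open>B = U J V\<close>, where \<open>J\<close> is the diagonal matrix with \<open>k\<close> zeros followed by \<open>n - k\<close> ones.
  Each minor of \<open>B\<close> of size \<open>n - k\<close> is then the product of one minor from the last \<open>n - k\<close> columns
  of \<open>U\<close> and one from the last \<open>n - k\<close> rows of \<open>V\<close>, and Jacobi's identity turns these into
  complementary minors of the inverses. The first \<open>k\<close> columns of \<open>V\<close> inverse and the first \<open>k\<close> rows
  of \<open>U\<close> inverse span the kernels of \<open>B\<close> and of its transpose, so the \<open>k\<close>th adjugate is
  \<open>d x y\<close>, with \<open>d = det U det V\<close> and \<open>x\<close> (a column), \<open>y\<close> (a row) nonzero wedges of kernel vectors.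
  Hence (ii) holds iff the scalar in front of the outer product is nonzero. The geometric multiplicity
  bounds the algebraic one from below, so this means that the multiplicity is exactly \<open>k\<close>.\<close>

section \<open>Complementary minors\<close>

lemma nth_sorted_list_of_set_mem: "i < card S \<Longrightarrow> sorted_list_of_set S ! i \<in> S"
  by (metis card.infinite length_sorted_list_of_set not_less_zero nth_mem set_sorted_list_of_set)

text \<open>\<open>pick I i\<close> is the only element of \<open>I\<close> with exactly
  \<open>i\<close> smaller elements in \<open>I\<close>. In the sorted list these are the entries at
  positions below \<open>i\<close>.\<close>

lemma pick_eq_sorted_list_of_set:
  assumes "finite I" "i < card I"
  shows "pick I i = sorted_list_of_set I ! i"
proof -
  let ?l = "sorted_list_of_set I"
  have len: "length ?l = card I" by simp
  have sd: "sorted_wrt (<) ?l" by (rule strict_sorted_list_of_set)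
  have "{a \<in> I. a < ?l ! i} = (!) ?l ` {..<i}" (is "?L = ?R")
  proof
    show "?R \<subseteq> ?L"
    proof
      fix x assume "x \<in> ?R"
      then obtain j where j: "j < i" "x = ?l ! j" by auto
      then have "x < ?l ! i" using sd assms len by (simp add: sorted_wrt_nth_less)
      moreover have "x \<in> I" using j assms by (simp add: nth_sorted_list_of_set_mem)
      ultimately show "x \<in> ?L" by simp
    qed
    show "?L \<subseteq> ?R"
    proof
      fix x assume x: "x \<in> ?L"
      then obtain j where j: "j < card I" "x = ?l ! j"
        using assms len in_set_conv_nth[of x ?l] by auto
      have "j < i"
      proof (rule ccontr)
        assume "\<not> j < i"
        then have "?l ! i \<le> ?l ! j" using j len by (intro sorted_nth_mono) auto
        then show False using x j by auto
      qed
      then show "x \<in> ?R" using j by auto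
    qed
  qed
  moreover have "inj_on ((!) ?l) {..<i}"
    using assms len by (intro inj_on_nth) auto
  ultimately have "card {a \<in> I. a < ?l ! i} = i"
    by (simp add: card_image)
  moreover have "?l ! i \<in> I" using assms by (simp add: nth_sorted_list_of_set_mem)
  ultimately show ?thesis using pick_card_in_set by metis
qed

lemma submatrix_eq_mat_sorted:
  assumes "I \<subseteq> {..<dim_row A}" "J \<subseteq> {..<dim_col A}"
  shows "submatrix A I J = mat (card I) (card J)
    (\<lambda>(i, j). A $$ (sorted_list_of_set I ! i, sorted_list_of_set J ! j))"
proof -
  have "{i. i < dim_row A \<and> i \<in> I} = I" "{j. j < dim_col A \<and> j \<in> J} = J"
    using assms by auto
  moreover have "finite I" "finite J" using assms finite_subset by blast+
  ultimately show ?thesis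
    unfolding submatrix_def by (intro eq_matI) (auto simp: pick_eq_sorted_list_of_set)
qed

lemma sorted_list_of_set_insert_greater:
  assumes "finite S" "\<And>x. x \<in> S \<Longrightarrow> x < (n :: nat)"
  shows "sorted_list_of_set (insert n S) = sorted_list_of_set S @ [n]"
proof -
  have "insert n S = set (sorted_list_of_set S @ [n])" using assms(1) by auto
  moreover have "sorted (sorted_list_of_set S @ [n])" "distinct (sorted_list_of_set S @ [n])"
    using assms by (auto simp: sorted_append less_imp_le)
  ultimately show ?thesis by (metis sorted_list_of_set.idem_if_sorted_distinct)
qed

lemma nth_sorted_list_of_set_less:
  assumes "S \<subseteq> {..<n}" "i < card S"
  shows "sorted_list_of_set S ! i < n"
  using assms nth_sorted_list_of_set_mem by blast

lemma index_mult_mat_sum: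
  assumes "A \<in> carrier_mat nr n" "B \<in> carrier_mat n nc" "i < nr" "j < nc"
  shows "(A * B) $$ (i, j) = (\<Sum>l = 0..<n. A $$ (i, l) * B $$ (l, j))"
  using assms by (auto simp: scalar_prod_def)

section \<open>The sign of a shuffle of unit vectors\<close>

text \<open>Expand along the bottom row: its only nonzero entry is the 1 in column
  \<open>length us\<close>, so a single cofactor survives. Its sign exponent
  \<open>n + length us\<close> has the parity of \<open>length vs\<close>.\<close>

lemma det_unit_vecs_insert:
  assumes n: "length us + length vs = n" and sub: "set us \<union> set vs \<subseteq> {..<n}"
  shows "det (mat_of_cols (Suc n) (map (unit_vec (Suc n)) (us @ n # vs))) =
    (-1) ^ length vs * det (mat_of_cols n (map (unit_vec n) (us @ vs)) :: 'a :: comm_ring_1 mat)"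
    (is "det ?M = _ * det ?N")
proof -
  let ?l = "length us"
  have M: "?M \<in> carrier_mat (Suc n) (Suc n)" using n by auto
  have ne: "n \<notin> set us" "n \<notin> set vs" using sub by auto
  have entry: "?M $$ (n, j) = (if j = ?l then 1 else 0)" if "j < Suc n" for j
  proof -
    have "(us @ n # vs) ! j = n \<longleftrightarrow> j = ?l"
      using that n ne in_set_conv_nth[of n us] in_set_conv_nth[of n vs]
      by (cases "j < ?l") (auto simp: nth_append nth_Cons' simp del: in_set_conv_nth)
    moreover have "?M $$ (n, j) = unit_vec (Suc n) ((us @ n # vs) ! j) $ n"
      using that n by (simp add: mat_of_cols_index del: map_append)
    ultimately show ?thesis using that n by (auto simp: unit_vec_def)
  qed
  have del: "mat_delete ?M n ?l = ?N"
  proof (rule eq_matI)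
    fix i j assume "i < dim_row ?N" "j < dim_col ?N"
    then have i: "i < n" and j: "j < n" using n by auto
    define j' where "j' = (if j < ?l then j else Suc j)"
    have "mat_delete ?M n ?l $$ (i, j) = ?M $$ (i, j')"
      using i j n unfolding mat_delete_def j'_def by auto
    also have "\<dots> = unit_vec (Suc n) ((us @ n # vs) ! j') $ i"
      using i j n unfolding j'_def by (simp add: mat_of_cols_index del: map_append)
    also have "(us @ n # vs) ! j' = (us @ vs) ! j"
      using j unfolding j'_def by (auto simp: nth_append)
    also have "unit_vec (Suc n) ((us @ vs) ! j) $ i = (unit_vec n ((us @ vs) ! j) :: 'a vec) $ i"
      using i by (simp add: unit_vec_def)
    also have "\<dots> = ?N $$ (i, j)"
      using i j n by (simp add: mat_of_cols_index del: map_append)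
    finally show "mat_delete ?M n ?l $$ (i, j) = ?N $$ (i, j)" .
  qed (use n in auto)
  have "det ?M = (\<Sum>j<Suc n. ?M $$ (n, j) * cofactor ?M n j)"
    by (rule laplace_expansion_row[OF M]) simp
  also have "\<dots> = (\<Sum>j<Suc n. if j = ?l then cofactor ?M n j else 0)"
    by (intro sum.cong refl) (simp add: entry del: map_append)
  also have "\<dots> = cofactor ?M n ?l" using n by simp
  also have "\<dots> = (-1) ^ (n + ?l) * det ?N" unfolding cofactor_def del ..
  also have "(-1 :: 'a) ^ (n + ?l) = (-1) ^ length vs"
    unfolding n[symmetric] by (simp add: power_add mult_ac)
  finally show ?thesis .
qed

text \<open>The sign of the permutation listing \<open>S\<close> and then its complement.\<close>

lemma det_unit_vecs_shuffle:
  assumes "S \<subseteq> {..<n}"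
  shows "det (mat_of_cols n (map (unit_vec n)
      (sorted_list_of_set S @ sorted_list_of_set ({..<n} - S))) :: 'a :: comm_ring_1 mat) =
    (-1) ^ (\<Sum>S + \<Sum>{..<card S})"
  using assms
proof (induction n arbitrary: S)
  case 0
  then show ?case by (simp add: det_def)
next
  case (Suc n)
  show ?case
  proof (cases "n \<in> S")
    case False
    then have S: "S \<subseteq> {..<n}" using Suc.prems by (auto simp: less_Suc_eq)
    have fin: "finite S" using S finite_subset by blast
    have "{..<Suc n} - S = insert n ({..<n} - S)" using False by auto
    then have eq: "sorted_list_of_set ({..<Suc n} - S) = sorted_list_of_set ({..<n} - S) @ [n]"
      by (metis Diff_iff finite_Diff finite_lessThan lessThan_iff sorted_list_of_set_insert_greater)
    have "card S + card ({..<n} - S) = n"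
      using S fin card_mono[OF _ S] by (simp add: card_Diff_subset)
    \<comment> \<open>Here \<open>n\<close> comes last in the whole list, so its insertion costs no
      sign, and the exponent is unchanged.\<close>
    then show ?thesis
      using det_unit_vecs_insert[of "sorted_list_of_set S @ sorted_list_of_set ({..<n} - S)" "[]" n, where 'a = 'a]
        S fin Suc.IH[OF S] unfolding eq by simp
  next
    case True
    define T where "T = S - {n}"
    have T: "T \<subseteq> {..<n}" and S: "S = insert n T" "n \<notin> T"
      using Suc.prems True by (auto simp: less_Suc_eq T_def)
    have fin: "finite T" using T finite_subset by blast
    have c: "{..<Suc n} - S = {..<n} - T" using S by auto
    have eq: "sorted_list_of_set S = sorted_list_of_set T @ [n]"
      unfolding S using T fin by (intro sorted_list_of_set_insert_greater) auto
    have cn: "card T + card ({..<n} - T) = n"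
      using T fin card_mono[OF _ T] by (simp add: card_Diff_subset)
    \<comment> \<open>Inserting \<open>n\<close> before the complement costs
      \<open>card ({..<n} - T)\<close> sign changes. The exponent grows by \<open>n\<close> in the
      sum over \<open>S\<close> and by \<open>card T\<close> in the sum over
      \<open>{..<card S}\<close>; the parities agree.\<close>
    have "n + card T = card ({..<n} - T) + 2 * card T" using cn by simp
    then have "(-1 :: 'a) ^ card ({..<n} - T) = (-1) ^ (n + card T)"
      by (simp only: power_add power_mult) simp
    then show ?thesis
      using det_unit_vecs_insert[of "sorted_list_of_set T" "sorted_list_of_set ({..<n} - T)" n, where 'a = 'a]
        T fin cn Suc.IH[OF T] unfolding c eq by (simp add: S(1) fin S(2) power_add algebra_simps)
  qed
qed

section \<open>Jacobi's identity for the bottom rows\<close>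

lemma submatrix_carrier_mat:
  assumes "I \<subseteq> {..<dim_row A}" "J \<subseteq> {..<dim_col A}"
  shows "submatrix A I J \<in> carrier_mat (card I) (card J)"
  by (simp add: submatrix_eq_mat_sorted[OF assms])

text \<open>List the rows in \<open>S\<close> first and the others after them. The matrix becomes
  block lower triangular, because the unit columns vanish on the rows in \<open>S\<close> and form
  an identity on the rest. The diagonal block left over is the minor of \<open>Z\<close>; the sign
  is that of the reordering.\<close>

lemma det_unit_vec_columns:
  fixes Z :: "'a :: idom mat"
  assumes Z: "Z \<in> carrier_mat n n" and S: "S \<subseteq> {..<n}"
  defines "C \<equiv> {..<n} - S"
  defines "k \<equiv> card S"
  shows "det (mat n n (\<lambda>(i, j). if j < k then Z $$ (i, j)
      else unit_vec n (sorted_list_of_set C ! (j - k)) $ i)) =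
    (-1) ^ (\<Sum>S + \<Sum>{..<k}) * det (submatrix Z S {..<k})"
    (is "det ?W = _ * det ?X")
proof -
  let ?Y = "submatrix Z C {..<k}"
  let ?F = "four_block_mat ?X (0\<^sub>m k (n - k)) ?Y (1\<^sub>m (n - k))"
  let ?s = "sorted_list_of_set S" and ?c = "sorted_list_of_set C"
  define xs where "xs = ?s @ ?c"
  define E where "E = (mat_of_cols n (map (unit_vec n) xs) :: 'a mat)"
  have fS: "finite S" and fC: "finite C" using S finite_subset unfolding C_def by blast+
  have kn: "k \<le> n" using card_mono[OF _ S] unfolding k_def by simp
  have cC: "card C = n - k" using S fS by (simp add: C_def k_def card_Diff_subset)
  have C: "C \<subseteq> {..<n}" unfolding C_def by blast
  have kk: "{..<k} \<subseteq> {..<n}" using kn by auto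
  have lx: "length xs = n" using kn by (simp add: xs_def cC k_def[symmetric])
  have dx: "distinct xs" using fS fC by (auto simp: xs_def C_def)
  have sx: "set xs = {..<n}" using fS fC S by (auto simp: xs_def C_def)
  have X: "?X \<in> carrier_mat k k" and Y: "?Y \<in> carrier_mat (n - k) k"
    using submatrix_carrier_mat[of S Z "{..<k}"] submatrix_carrier_mat[of C Z "{..<k}"] Z S C kk
    by (auto simp: cC k_def)
  have Xe: "?X $$ (i, j) = Z $$ (?s ! i, j)" if "i < k" "j < k" for i j
    using that Z S kk by (simp add: submatrix_eq_mat_sorted k_def[symmetric] lessThan_atLeast0)
  have Ye: "?Y $$ (i, j) = Z $$ (?c ! i, j)" if "i < n - k" "j < k" for i j
    using that Z C kk by (simp add: submatrix_eq_mat_sorted cC lessThan_atLeast0)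
  have F: "?F \<in> carrier_mat n n"
    using four_block_carrier_mat[OF X, of "1\<^sub>m (n - k)" "n - k" "n - k"] kn by simp
  have E: "E \<in> carrier_mat n n" using lx by (auto simp: E_def)
  have less: "xs ! l < n" if "l < n" for l using nth_mem[of l xs] that lx sx by auto
  have W: "?W $$ (xs ! l, j) = ?F $$ (l, j)" if l: "l < n" and j: "j < n" for l j
  proof (cases "l < k")
    case True
    then have x: "xs ! l = ?s ! l" "xs ! l \<in> S"
      using fS nth_sorted_list_of_set_mem[of l S] by (auto simp: xs_def nth_append k_def)
    have ne: "?c ! (j - k) \<noteq> ?s ! l" if "\<not> j < k"
    proof -
      have "?c ! (j - k) \<in> C"
        using that j cC by (intro nth_sorted_list_of_set_mem) auto
      then show ?thesis using x unfolding C_def by auto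
    qed
    then show ?thesis using True l j less[OF l] X Y ne[THEN not_sym]
      by (cases "j < k") (simp_all add: Xe x(1) unit_vec_def)
  next
    case False
    then have x: "xs ! l = ?c ! (l - k)"
      using fS by (auto simp: xs_def nth_append k_def)
    have eq: "?c ! (l - k) = ?c ! (j - k) \<longleftrightarrow> j = l" if "\<not> j < k"
      using that False j l cC fC by (subst nth_eq_iff_index_eq) auto
    show ?thesis
    proof (cases "j < k")
      case True
      then show ?thesis using False l j less[OF l] X Y x by (simp add: Ye)
    next
      case nj: False
      then show ?thesis using False l j less[OF l] X Y x eq[OF nj] by (auto simp: unit_vec_def)
    qed
  qed
  \<comment> \<open>Left multiplication by \<open>E\<close> moves row \<open>l\<close> to row
    \<open>xs ! l\<close>, which undoes the reordering.\<close>
  have "?W = E * ?F"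
  proof (rule eq_matI)
    fix i j assume "i < dim_row (E * ?F)" "j < dim_col (E * ?F)"
    then have i: "i < n" and j: "j < n" using E F by auto
    then obtain l where l: "l < n" "i = xs ! l" using sx lx by (metis in_set_conv_nth lessThan_iff)
    have "(E * ?F) $$ (i, j) = (\<Sum>m = 0..<n. E $$ (i, m) * ?F $$ (m, j))"
      using index_mult_mat_sum[OF E F i j] .
    also have "\<dots> = (\<Sum>m = 0..<n. if m = l then ?F $$ (m, j) else 0)"
    proof (rule sum.cong[OF refl])
      fix m assume "m \<in> {0..<n}"
      then have m: "m < n" by simp
      then have "E $$ (i, m) = (if m = l then 1 else 0)"
        using l i lx dx less[OF m] by (simp add: E_def mat_of_cols_index nth_eq_iff_index_eq)
      then show "E $$ (i, m) * ?F $$ (m, j) = (if m = l then ?F $$ (m, j) else 0)"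
        by (simp del: index_mat_four_block)
    qed
    also have "\<dots> = ?F $$ (l, j)" using l by (simp del: index_mat_four_block)
    finally have "(E * ?F) $$ (i, j) = ?F $$ (l, j)" .
    then show "?W $$ (i, j) = (E * ?F) $$ (i, j)"
      unfolding l(2) using W[OF l(1) j] by (simp only:)
  qed (use E F in auto)
  then have "det ?W = det E * det ?F" using det_mult[OF E F] by simp
  also have "det ?F = det ?X"
    using det_four_block_mat_upper_right_zero[OF X refl Y one_carrier_mat] by simp
  also have "det E = (-1) ^ (\<Sum>S + \<Sum>{..<k})"
    unfolding E_def xs_def C_def k_def by (rule det_unit_vecs_shuffle[OF S])
  finally show ?thesis .
qed

text \<open>Jacobi's identity: \<open>V W\<close> is block triangular when \<open>W\<close> consists of the first \<open>k\<close> columns of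
  \<open>Z\<close> and the unit vectors with index outside \<open>S\<close>.\<close>

lemma det_complementary_minor:
  fixes V Z :: "'a :: idom mat"
  assumes V: "V \<in> carrier_mat n n" and Z: "Z \<in> carrier_mat n n" and VZ: "V * Z = 1\<^sub>m n"
    and S: "S \<subseteq> {..<n}" and k: "card S = k"
  shows "det (submatrix V {k..<n} ({..<n} - S)) =
    (-1) ^ (\<Sum>S + \<Sum>{..<k}) * det V * det (submatrix Z S {..<k})"
proof -
  define C where "C = {..<n} - S"
  let ?c = "sorted_list_of_set C"
  define W where "W = mat n n (\<lambda>(i, j). if j < k then Z $$ (i, j)
      else unit_vec n (?c ! (j - k)) $ i)"
  let ?G = "four_block_mat (1\<^sub>m k) (mat k (n - k) (\<lambda>(i, j). V $$ (i, ?c ! j)))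
    (0\<^sub>m (n - k) k) (submatrix V {k..<n} C)"
  have fS: "finite S" using S finite_subset by blast
  have kn: "k \<le> n" using card_mono[OF _ S] k by simp
  have cC: "card C = n - k" using S fS by (simp add: C_def k card_Diff_subset)
  have C: "C \<subseteq> {..<n}" unfolding C_def by blast
  have W: "W \<in> carrier_mat n n" by (simp add: W_def)
  have K: "{k..<n} \<subseteq> {..<n}" by auto
  have D: "submatrix V {k..<n} C \<in> carrier_mat (n - k) (n - k)"
    using submatrix_carrier_mat[of "{k..<n}" V C] V C K by (simp add: cC)
  have De: "submatrix V {k..<n} C $$ (i, j) = V $$ (k + i, ?c ! j)" if "i < n - k" "j < n - k" for i j
    using that V C K by (simp add: submatrix_eq_mat_sorted cC)
  have less: "?c ! j < n" if "j < n - k" for j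
    using nth_sorted_list_of_set_less[OF C] that cC by simp
  \<comment> \<open>Where \<open>W\<close> copies \<open>Z\<close>, the product shows columns of
    \<open>V * Z\<close>, the identity. A unit column of \<open>W\<close> picks out a column of
    \<open>V\<close> with index outside \<open>S\<close>.\<close>
  have "V * W = ?G"
  proof (rule eq_matI)
    fix i j assume "i < dim_row ?G" "j < dim_col ?G"
    then have i: "i < n" and j: "j < n" using D kn by auto
    show "(V * W) $$ (i, j) = ?G $$ (i, j)"
    proof (cases "j < k")
      case True
      then have "col W j = col Z j" using Z j by (intro eq_vecI) (auto simp: W_def)
      then have "(V * W) $$ (i, j) = (V * Z) $$ (i, j)"
        using V W Z i j by simp
      then show ?thesis unfolding VZ using i j True D by auto
    next
      case False
      then have jk: "j - k < n - k" using j by simp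
      have "col W j = unit_vec n (?c ! (j - k))" using j False by (intro eq_vecI) (auto simp: W_def)
      then have "(V * W) $$ (i, j) = V $$ (i, ?c ! (j - k))"
        using V W i j less[OF jk] by (simp add: scalar_prod_right_unit)
      then show ?thesis using i j False D jk by (auto simp: De)
    qed
  qed (use V W D kn in auto)
  moreover have "det ?G = det (submatrix V {k..<n} C)"
    using det_four_block_mat_lower_left_zero[OF one_carrier_mat _ refl D] by simp
  ultimately have "det (submatrix V {k..<n} C) = det V * det W"
    using det_mult[OF V W] by simp
  also have "det W = (-1) ^ (\<Sum>S + \<Sum>{..<k}) * det (submatrix Z S {..<k})"
    using det_unit_vec_columns[OF Z S] unfolding W_def C_def k .
  finally show ?thesis by (simp add: C_def mult_ac)
qed

section \<open>Nonvanishing minors in the first columns of an invertible matrix\<close>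

text \<open>Laplace expansion along the last column passes from \<open>k + 1\<close> to \<open>k\<close>.\<close>

lemma exists_nonzero_minor_list:
  fixes Z :: "'a :: comm_ring_1 mat"
  assumes Z: "Z \<in> carrier_mat n n" "det Z \<noteq> 0" and "k \<le> n"
  shows "\<exists>xs. length xs = k \<and> sorted_wrt (<) xs \<and> set xs \<subseteq> {..<n} \<and>
    det (mat k k (\<lambda>(i, j). Z $$ (xs ! i, j))) \<noteq> 0"
  using \<open>k \<le> n\<close>
proof (induction k rule: inc_induct)
  case base
  have "mat n n (\<lambda>(i, j). Z $$ ([0..<n] ! i, j)) = Z" using Z by (intro eq_matI) auto
  then show ?case using Z by (intro exI[of _ "[0..<n]"]) auto
next
  case (step k)
  then obtain xs where xs: "length xs = Suc k" "sorted_wrt (<) xs" "set xs \<subseteq> {..<n}"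
    and det: "det (mat (Suc k) (Suc k) (\<lambda>(i, j). Z $$ (xs ! i, j))) \<noteq> 0" (is "det ?M \<noteq> 0")
    by blast
  have M: "?M \<in> carrier_mat (Suc k) (Suc k)" by simp
  have "\<exists>i<Suc k. cofactor ?M i k \<noteq> 0"
  proof (rule ccontr)
    assume "\<not> ?thesis"
    then have "det ?M = 0" using laplace_expansion_column[OF M, of k] by simp
    then show False using det by simp
  qed
  then obtain i where i: "i < Suc k" and c: "det (mat_delete ?M i k) \<noteq> 0"
    unfolding cofactor_def by (metis mult_zero_right)
  \<comment> \<open>Dropping the row index at position \<open>i\<close> keeps the list increasing
    and gives exactly the minor in the nonzero cofactor.\<close>
  define ys where "ys = take i xs @ drop (Suc i) xs"
  have ly: "length ys = k" using xs i by (simp add: ys_def)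
  have "xs = take i xs @ xs ! i # drop (Suc i) xs" using xs i by (simp add: id_take_nth_drop)
  then have "sorted_wrt (<) (take i xs @ xs ! i # drop (Suc i) xs)" using xs by simp
  then have sy: "sorted_wrt (<) ys"
    unfolding ys_def by (auto simp: sorted_wrt_append)
  have sub: "set ys \<subseteq> {..<n}"
    using xs(3) set_take_subset[of i xs] set_drop_subset[of "Suc i" xs] by (auto simp: ys_def)
  have "mat_delete ?M i k = mat k k (\<lambda>(i, j). Z $$ (ys ! i, j))"
    using i xs by (intro eq_matI) (auto simp: mat_delete_def ys_def nth_append min_def)
  then show ?case using ly sy sub c by auto
qed

lemma exists_nonzero_minor:
  fixes Z :: "'a :: comm_ring_1 mat"
  assumes Z: "Z \<in> carrier_mat n n" "det Z \<noteq> 0" and "k \<le> n"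
  obtains S where "S \<subseteq> {..<n}" "card S = k" "det (submatrix Z S {..<k}) \<noteq> 0"
proof -
  obtain xs where xs: "length xs = k" "sorted_wrt (<) xs" "set xs \<subseteq> {..<n}"
    and det: "det (mat k k (\<lambda>(i, j). Z $$ (xs ! i, j))) \<noteq> 0"
    using exists_nonzero_minor_list[OF assms] by blast
  have sl: "sorted_list_of_set (set xs) = xs" and c: "card (set xs) = k"
    using xs by (auto simp: strict_sorted_iff sorted_list_of_set.idem_if_sorted_distinct distinct_card)
  have "submatrix Z (set xs) {..<k} = mat k k (\<lambda>(i, j). Z $$ (xs ! i, j))"
    using Z xs(3) \<open>k \<le> n\<close>
    by (subst submatrix_eq_mat_sorted) (auto simp: c sl lessThan_atLeast0)
  then show ?thesis using that[of "set xs"] xs(3) c det by simp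
qed

section \<open>Factorization along the kernel\<close>

lemma mat_of_cols_append_mult_vec:
  assumes "u \<in> carrier_vec (length xs)" "w \<in> carrier_vec (length ys)"
  shows "mat_of_cols n (xs @ ys) *\<^sub>v (u @\<^sub>v w) = mat_of_cols n xs *\<^sub>v u + mat_of_cols n ys *\<^sub>v w"
proof (rule eq_vecI)
  fix i assume "i < dim_vec (mat_of_cols n xs *\<^sub>v u + mat_of_cols n ys *\<^sub>v w)"
  then have i: "i < n" by simp
  have "row (mat_of_cols n (xs @ ys)) i = row (mat_of_cols n xs) i @\<^sub>v row (mat_of_cols n ys) i"
    using i by (intro eq_vecI) (auto simp: mat_of_cols_index nth_append)
  then show "(mat_of_cols n (xs @ ys) *\<^sub>v (u @\<^sub>v w)) $ i =
      (mat_of_cols n xs *\<^sub>v u + mat_of_cols n ys *\<^sub>v w) $ i"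
    using i assms by (simp add: scalar_prod_append[of _ "length xs" _ "length ys"])
qed simp

lemma mult_mat_of_cols:
  assumes "A \<in> carrier_mat m n" "set xs \<subseteq> carrier_vec n"
  shows "A * mat_of_cols n xs = mat_of_cols m (map ((*\<^sub>v) A) xs)"
proof (rule eq_matI)
  fix i j assume "i < dim_row (mat_of_cols m (map ((*\<^sub>v) A) xs))" "j < dim_col (mat_of_cols m (map ((*\<^sub>v) A) xs))"
  moreover from this have "xs ! j \<in> carrier_vec n" using assms by auto
  ultimately show "(A * mat_of_cols n xs) $$ (i, j) = mat_of_cols m (map ((*\<^sub>v) A) xs) $$ (i, j)"
    using assms by (auto simp: mat_of_cols_index)
qed (use assms in auto)

context vec_space
begin

lemma mat_of_cols_det_nonzero:
  assumes "set zs \<subseteq> carrier_vec n" "distinct zs" "length zs = n" "lin_indpt (set zs)"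
  shows "det (mat_of_cols n zs) \<noteq> 0"
proof -
  have "mat_of_cols n zs \<in> carrier_mat n n" using assms(3) by auto
  moreover have "cols (mat_of_cols n zs) = zs" using assms by (intro cols_mat_of_cols)
  ultimately show ?thesis using lin_indpt_full_rank det_rank_iff assms by metis
qed

text \<open>Cardinalities of independent sets are bounded by the dimension, so some independent set
  containing \<open>set xs\<close> has greatest cardinality. It is maximal, hence a basis. The new
  vectors are returned as a separate list so that they can be put after or before the given
  ones.\<close>

lemma extend_to_basis_list:
  assumes "set xs \<subseteq> carrier_vec n" "distinct xs" "lin_indpt (set xs)"
  obtains ys where "set ys \<subseteq> carrier_vec n" "distinct (xs @ ys)" "length xs + length ys = n"
    "lin_indpt (set xs \<union> set ys)"
proof -
  let ?P = "\<lambda>T. T \<subseteq> carrier_vec n \<and> lin_indpt T"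
  have bound: "finite T \<and> card T \<le> n" if "?P T" for T
    using that li_le_dim[of T] fin_dim dim_is_n by simp
  have "?P (set xs) \<and> set xs \<subseteq> set xs" using assms by simp
  from ex_has_greatest_nat[of "\<lambda>T. ?P T \<and> set xs \<subseteq> T" "set xs" card "Suc n", OF this]
  obtain A where P: "?P A" and sub: "set xs \<subseteq> A"
    and max: "\<And>T. ?P T \<Longrightarrow> set xs \<subseteq> T \<Longrightarrow> card T \<le> card A"
    using bound by (metis le_imp_less_Suc)
  have "maximal A ?P"
    unfolding maximal_def
  proof (intro conjI allI impI)
    fix T assume T: "A \<subseteq> T \<and> ?P T"
    then show "T = A"
      using max[of T] bound[of T] sub by (metis card_seteq order_trans)
  qed (use P in auto)
  then have A: "finite A" "maximal A ?P" "set xs \<subseteq> A"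
    using bound P sub by auto
  have b: "basis A" using A(2) by (intro max_li_is_basis) simp
  then have c: "card A = n" using dim_basis[OF A(1)] dim_is_n by simp
  obtain ys where ys: "set ys = A - set xs" "distinct ys"
    using finite_distinct_list[of "A - set xs"] A(1) by auto
  have "length xs + length ys = n"
    using c ys A assms(2) by (metis add_diff_inverse_nat card_Diff_subset card_mono distinct_card finite_set not_le)
  moreover have "set xs \<union> set ys = A" using ys A by auto
  ultimately show ?thesis using that[of ys] ys A(2) assms unfolding maximal_def by auto
qed

lemma in_span_finite_lincomb:
  assumes "finite S" "S \<subseteq> carrier_vec n" "v \<in> span S"
  shows "\<exists>a. v = lincomb a S"
  using finite_in_span[of S v] assms by auto

text \<open>Two equal columns would put a difference of unit vectors into the kernel, and a linear
  relation among distinct columns is itself a kernel vector. Distinctness comes first because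
  independence concerns the set of columns.\<close>

lemma inj_mat_cols:
  assumes N: "N \<in> carrier_mat n m"
    and inj: "\<And>w. w \<in> carrier_vec m \<Longrightarrow> N *\<^sub>v w = 0\<^sub>v n \<Longrightarrow> w = 0\<^sub>v m"
  shows "distinct (cols N)" "lin_indpt (set (cols N))"
proof -
  show d: "distinct (cols N)"
    unfolding distinct_conv_nth
  proof (intro allI impI notI)
    fix i j assume ij: "i < length (cols N)" "j < length (cols N)" "i \<noteq> j" and eq: "cols N ! i = cols N ! j"
    then have i: "i < m" and j: "j < m" using N by auto
    have unit: "N *\<^sub>v unit_vec m l = col N l" if "l < m" for l
      using N that by (intro eq_vecI) auto
    have "N *\<^sub>v (unit_vec m i - unit_vec m j) = col N i - col N j"
      using N i j by (simp add: mult_minus_distrib_mat_vec unit)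
    also have "\<dots> = 0\<^sub>v n" using eq N i j by simp
    finally have "unit_vec m i - unit_vec m j = (0\<^sub>v m :: 'a vec)" using inj by simp
    then have "(unit_vec m i - unit_vec m j) $ i = (0\<^sub>v m :: 'a vec) $ i" by simp
    then show False using i j ij(3) by simp
  qed
  show "lin_indpt (set (cols N))"
  proof
    assume "lin_dep (set (cols N))"
    then obtain v where "v \<in> carrier_vec m" "v \<noteq> 0\<^sub>v m" "N *\<^sub>v v = 0\<^sub>v n"
      using lin_depE[OF N _ d] by blast
    then show False using inj by blast
  qed
qed

end

text \<open>A basis \<open>xs\<close> of the kernel, extended by \<open>ys\<close>, gives
  \<open>Z\<close>. On the span of \<open>ys\<close> the map \<open>B\<close> is injective, so the
  images \<open>ws\<close> of \<open>ys\<close> are independent; preceded by further basis vectors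
  \<open>vs\<close> they give \<open>U\<close>.\<close>

lemma kernel_dim_factorization:
  fixes B :: "'a :: field mat"
  assumes B: "B \<in> carrier_mat n n" and k: "kernel_dim B = k"
  obtains U Z where "U \<in> carrier_mat n n" "Z \<in> carrier_mat n n" "det U \<noteq> 0" "det Z \<noteq> 0" "k \<le> n"
    "B * Z = U * mat n n (\<lambda>(i, j). if i = j \<and> k \<le> i then 1 else 0)"
proof -
  interpret kernel n n B by unfold_locales (rule B)
  obtain S where S: "finite S" "basis S" using kernel_basis_exists[OF B] by blast
  have cS: "card S = k" using Ker.dim_basis[OF S] k by simp
  have SK: "S \<subseteq> mat_kernel B" using S(2) unfolding Ker.basis_def by simp
  have gen: "span S = mat_kernel B" using S(2) unfolding Ker.basis_def by simp
  have liS: "NC.lin_indpt S" using S(2) lindep_same[OF SK] unfolding Ker.basis_def by simp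
  have SC: "S \<subseteq> carrier_vec n" using SK mat_kernel_carrier[OF B] by blast
  obtain xs where xs: "set xs = S" "distinct xs" using finite_distinct_list[OF S(1)] by blast
  have lx: "length xs = k" using xs cS distinct_card by fastforce
  obtain ys where ys: "set ys \<subseteq> carrier_vec n" "distinct (xs @ ys)" "length xs + length ys = n"
    "NC.lin_indpt (set xs \<union> set ys)"
    using NC.extend_to_basis_list[of xs] xs SC liS by blast
  define Z where "Z = mat_of_cols n (xs @ ys)"
  have Z: "Z \<in> carrier_mat n n" using ys(3) by (auto simp: Z_def)
  have dZ: "det Z \<noteq> 0" unfolding Z_def
    using ys xs SC by (intro NC.mat_of_cols_det_nonzero) auto
  have kn: "k \<le> n" using ys(3) lx by simp
  define m where "m = length ys"
  define X Y where "X = mat_of_cols n xs" and "Y = mat_of_cols n ys"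
  have X: "X \<in> carrier_mat n k" and Y: "Y \<in> carrier_mat n m" by (auto simp: X_def Y_def lx m_def)
  define ws where "ws = map ((*\<^sub>v) B) ys"
  have N: "B * Y = mat_of_cols n ws" using ys(1) B by (simp add: Y_def ws_def mult_mat_of_cols)
  have wsC: "set ws \<subseteq> carrier_vec n" using B ys(1) by (auto simp: ws_def)
  have cN: "cols (B * Y) = ws" unfolding N using wsC by (rule cols_mat_of_cols)
  \<comment> \<open>If \<open>B\<close> kills \<open>Y w\<close>, then \<open>Y w\<close> lies in
    the kernel and equals some \<open>X u\<close>. Hence \<open>Z\<close> kills \<open>- u\<close>
    followed by \<open>w\<close>, and invertibility of \<open>Z\<close> forces \<open>w\<close> to
    be zero.\<close>
  have inj: "w = 0\<^sub>v m" if w: "w \<in> carrier_vec m" and 0: "(B * Y) *\<^sub>v w = 0\<^sub>v n" for w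
  proof -
    have "B *\<^sub>v (Y *\<^sub>v w) = 0\<^sub>v n" using 0 B Y w by (simp add: assoc_mult_mat_vec)
    then have "Y *\<^sub>v w \<in> span S" unfolding gen using B Y w by (intro mat_kernelI) auto
    then have "Y *\<^sub>v w \<in> NC.span S" using span_same[OF SK] by simp
    then obtain a where a: "Y *\<^sub>v w = NC.lincomb a S"
      using NC.in_span_finite_lincomb[OF S(1) SC] by blast
    have cX: "cols X = xs" unfolding X_def using xs SC by (intro cols_mat_of_cols) auto
    define u where "u = vec k (\<lambda>i. a (col X i))"
    have u: "u \<in> carrier_vec k" by (simp add: u_def)
    have Xu: "X *\<^sub>v u = Y *\<^sub>v w"
      unfolding a u_def using NC.mat_mult_eq_lincomb[OF X, of a] cX xs by simp
    have "Z *\<^sub>v ((- u) @\<^sub>v w) = X *\<^sub>v (- u) + Y *\<^sub>v w"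
      unfolding Z_def X_def Y_def using u w lx m_def by (intro mat_of_cols_append_mult_vec) auto
    also have "X *\<^sub>v (- u) = - (Y *\<^sub>v w)" unfolding Xu[symmetric]
      using X u by (intro eq_vecI) auto
    also have "- (Y *\<^sub>v w) + Y *\<^sub>v w = 0\<^sub>v n" using Y w by simp
    finally have "Z *\<^sub>v ((- u) @\<^sub>v w) = 0\<^sub>v n" .
    moreover have c: "(- u) @\<^sub>v w \<in> carrier_vec n" using u w ys(3) lx m_def by auto
    ultimately have "(- u) @\<^sub>v w = 0\<^sub>v n"
      using det_0_iff_vec_prod_zero_field[OF Z] dZ by blast
    then have e: "((- u) @\<^sub>v w) $ (k + i) = 0" if "i < m" for i
      using that ys(3) lx m_def by simp
    have "w $ i = 0" if "i < m" for i using e[OF that] that u w by simp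
    then show ?thesis using w by (intro eq_vecI) auto
  qed
  have BY: "B * Y \<in> carrier_mat n m" using B Y by simp
  have wsd: "distinct ws" "NC.lin_indpt (set ws)"
    using NC.inj_mat_cols[OF BY inj] unfolding cN by auto
  obtain vs where vs: "set vs \<subseteq> carrier_vec n" "distinct (ws @ vs)" "length ws + length vs = n"
    "NC.lin_indpt (set ws \<union> set vs)"
    using NC.extend_to_basis_list[OF wsC wsd] by blast
  \<comment> \<open>\<open>vs\<close> has length \<open>k\<close> and comes first, so it fills
    exactly the columns that the partial identity erases.\<close>
  define U where "U = mat_of_cols n (vs @ ws)"
  have U: "U \<in> carrier_mat n n" using vs(3) by (auto simp: U_def)
  have dU: "det U \<noteq> 0" unfolding U_def
    using vs wsC by (intro NC.mat_of_cols_det_nonzero) (auto simp: Un_commute)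
  have lv: "length vs = k" using vs(3) ys(3) lx by (simp add: ws_def)
  let ?J = "mat n n (\<lambda>(i, j). if i = j \<and> k \<le> i then 1 else 0 :: 'a)"
  have "B * Z = U * ?J"
  proof (rule eq_matI)
    fix i j assume "i < dim_row (U * ?J)" "j < dim_col (U * ?J)"
    then have i: "i < n" and j: "j < n" using U by auto
    have "(B * Z) $$ (i, j) = (B *\<^sub>v ((xs @ ys) ! j)) $ i"
      using i j B Z ys xs SC unfolding Z_def
      by (subst mult_mat_of_cols[OF B]) (auto simp: mat_of_cols_index simp del: map_append)
    also have "\<dots> = (if j < k then 0 else U $$ (i, j))"
    proof (cases "j < k")
      case True
      then have "xs ! j \<in> mat_kernel B" using xs SK lx nth_mem by blast
      then show ?thesis using True i lx B by (simp add: nth_append mat_kernelD)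
    next
      case False
      then show ?thesis using i j lx lv ys(3) vs(3) by (auto simp: U_def mat_of_cols_index nth_append ws_def)
    qed
    also have "\<dots> = (U * ?J) $$ (i, j)"
    proof -
      have "(U * ?J) $$ (i, j) = (\<Sum>l = 0..<n. U $$ (i, l) * (if l = j \<and> k \<le> l then 1 else 0))"
        using i j U by (subst index_mult_mat_sum) auto
      also have "\<dots> = (\<Sum>l = 0..<n. if l = j then (if k \<le> j then U $$ (i, j) else 0) else 0)"
        by (intro sum.cong) auto
      finally show ?thesis using j by simp
    qed
    finally show "(B * Z) $$ (i, j) = (U * ?J) $$ (i, j)" .
  qed (use B Z U in auto)
  then show ?thesis using that U Z dU dZ kn by blast
qed

lemma det_nonzero_obtain_inverse:
  fixes A :: "'a :: field mat"
  assumes A: "A \<in> carrier_mat n n" and d: "det A \<noteq> 0"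
  obtains B where "B \<in> carrier_mat n n" "A * B = 1\<^sub>m n" "B * A = 1\<^sub>m n"
  using det_non_zero_imp_unit[OF A d, of undefined] that
  by (auto simp: Units_def ring_mat_def)

section \<open>The adjugate as an outer product of wedges\<close>

lemma submatrix_mat_of_cols_take:
  assumes Z: "Z \<in> carrier_mat n n" and S: "S \<subseteq> {..<n}" and k: "k \<le> n"
  shows "submatrix (mat_of_cols n (map (col Z) [0..<k])) S UNIV = submatrix Z S {..<k}"
proof -
  have "{i. i < n \<and> i \<in> S} = S" "{j. j < n \<and> j < k} = {..<k}" using S k by auto
  moreover have "pick {..<k} j = j" if "j < k" for j
    using that by (simp add: pick_eq_sorted_list_of_set lessThan_atLeast0)
  moreover have "pick S i < n" if "i < card S" for i
    using pick_in_set_le[OF that] S by auto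
  ultimately show ?thesis
    using Z k unfolding submatrix_def by (intro eq_matI) (auto simp: pick_UNIV mat_of_cols_index)
qed

lemma wedge_cols_index:
  assumes Z: "Z \<in> carrier_mat n n" and k: "k \<le> n" and a: "a < n choose k"
  shows "wedge n (map (col Z) [0..<k]) $ a = det (submatrix Z (ksubsets n k ! a) {..<k})"
proof -
  have "ksubsets n k ! a \<in> set (ksubsets n k)" using a by (simp add: length_ksubsets)
  then have "ksubsets n k ! a \<subseteq> {..<n}" by (simp add: set_ksubsets)
  then show ?thesis using a submatrix_mat_of_cols_take[OF Z _ k] by (simp add: wedge_def)
qed

lemma dim_wedge: "dim_vec (wedge n xs) = n choose length xs"
  by (simp add: wedge_def)

lemma index_outer_product:
  "i < dim_vec v \<Longrightarrow> j < dim_vec w \<Longrightarrow> outer_product v w $$ (i, j) = v $ i * w $ j"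
  by (simp add: outer_product_def scalar_prod_def mat_of_cols_index)

lemma dim_outer_product [simp]:
  "dim_row (outer_product v w) = dim_vec v" "dim_col (outer_product v w) = dim_vec w"
  by (simp_all add: outer_product_def)

lemma submatrix_transpose:
  assumes "I \<subseteq> {..<dim_row A}" "J \<subseteq> {..<dim_col A}"
  shows "submatrix (transpose_mat A) J I = transpose_mat (submatrix A I J)"
  using assms nth_sorted_list_of_set_less[OF assms(1)] nth_sorted_list_of_set_less[OF assms(2)]
  by (intro eq_matI) (simp_all add: submatrix_eq_mat_sorted)

lemma mult_partial_identity:
  fixes U :: "'a :: comm_ring_1 mat"
  assumes U: "U \<in> carrier_mat n n"
  shows "U * mat n n (\<lambda>(i, j). if i = j \<and> k \<le> i then 1 else 0) =
    mat n n (\<lambda>(i, j). if k \<le> j then U $$ (i, j) else 0)" (is "U * ?J = ?R")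
proof (rule eq_matI)
  fix i j assume "i < dim_row ?R" "j < dim_col ?R"
  then have i: "i < n" and j: "j < n" by auto
  have "(U * ?J) $$ (i, j) = (\<Sum>l = 0..<n. U $$ (i, l) * ?J $$ (l, j))"
    using i j U by (intro index_mult_mat_sum) auto
  also have "\<dots> = (\<Sum>l = 0..<n. if l = j then (if k \<le> j then U $$ (i, j) else 0) else 0)"
    using j by (intro sum.cong) auto
  finally show "(U * ?J) $$ (i, j) = ?R $$ (i, j)" using i j by simp
qed (use U in auto)

text \<open>The partial identity removes the summation indices below \<open>k\<close>, leaving the
  fixed inner index set \<open>{k..<n}\<close>. For \<open>n - k\<close> rows and columns both
  factors are square, so a minor of \<open>B\<close> is one product instead of a Cauchy-Binet
  sum.\<close>

lemma submatrix_factorization: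
  fixes U V :: "'a :: comm_ring_1 mat"
  assumes U: "U \<in> carrier_mat n n" and V: "V \<in> carrier_mat n n" and k: "k \<le> n"
    and B: "B = U * mat n n (\<lambda>(i, j). if i = j \<and> k \<le> i then 1 else 0) * V"
    and I: "I \<subseteq> {..<n}" and J: "J \<subseteq> {..<n}"
  shows "submatrix B I J = submatrix U I {k..<n} * submatrix V {k..<n} J" (is "_ = ?U * ?V")
proof (rule eq_matI)
  let ?U' = "mat n n (\<lambda>(i, j). if k \<le> j then U $$ (i, j) else 0)"
  have B': "B = ?U' * V" unfolding B mult_partial_identity[OF U] ..
  have Bc: "B \<in> carrier_mat n n" using V unfolding B' by auto
  have K: "{k..<n} \<subseteq> {..<n}" by auto
  have Uc: "?U \<in> carrier_mat (card I) (n - k)" and Vc: "?V \<in> carrier_mat (n - k) (card J)"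
    using submatrix_carrier_mat[of I U "{k..<n}"] submatrix_carrier_mat[of "{k..<n}" V J] U V I J K by auto
  fix i j assume "i < dim_row (?U * ?V)" "j < dim_col (?U * ?V)"
  then have i: "i < card I" and j: "j < card J" using Uc Vc by auto
  let ?i = "sorted_list_of_set I ! i" and ?j = "sorted_list_of_set J ! j"
  have i': "?i < n" and j': "?j < n" using nth_sorted_list_of_set_less I J i j by auto
  have "submatrix B I J $$ (i, j) = B $$ (?i, ?j)"
    using Bc I J i j by (simp add: submatrix_eq_mat_sorted)
  also have "\<dots> = (\<Sum>l = 0..<n. ?U' $$ (?i, l) * V $$ (l, ?j))"
    unfolding B' using i' j' V by (intro index_mult_mat_sum) auto
  also have "\<dots> = (\<Sum>l = k..<n. U $$ (?i, l) * V $$ (l, ?j))"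
    using i' by (intro sum.mono_neutral_cong_right) auto
  also have "\<dots> = (\<Sum>l = 0..<n - k. U $$ (?i, k + l) * V $$ (k + l, ?j))"
    using sum.shift_bounds_nat_ivl[of "\<lambda>l. U $$ (?i, l) * V $$ (l, ?j)" 0 k "n - k"] k
    by (simp add: add.commute)
  also have "\<dots> = (\<Sum>l = 0..<n - k. ?U $$ (i, l) * ?V $$ (l, j))"
    using U V I J K i j by (intro sum.cong) (auto simp: submatrix_eq_mat_sorted)
  also have "\<dots> = (?U * ?V) $$ (i, j)"
    using index_mult_mat_sum[OF Uc Vc i j] by simp
  finally show "submatrix B I J $$ (i, j) = (?U * ?V) $$ (i, j)" .
next
  have "B \<in> carrier_mat n n" unfolding B using U V by (intro mult_carrier_mat[of _ n n]) auto
  then show "dim_row (submatrix B I J) = dim_row (?U * ?V)" "dim_col (submatrix B I J) = dim_col (?U * ?V)"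
    using U V I J by (auto simp: dim_submatrix)
qed

text \<open>A minor of \<open>B\<close> splits into a minor of \<open>U\<close> and one of
  \<open>V\<close>. By \<open>det_complementary_minor\<close> these become \<open>k\<close>-minors
  of the inverses \<open>R\<close> and \<open>Z\<close>, which are coordinates of the wedges. The
  signs cancel against those of the adjugate.\<close>

lemma adjugate_k_eq_outer_product:
  fixes U V Z R :: "'a :: field mat"
  assumes U: "U \<in> carrier_mat n n" and V: "V \<in> carrier_mat n n"
    and Z: "Z \<in> carrier_mat n n" and R: "R \<in> carrier_mat n n"
    and VZ: "V * Z = 1\<^sub>m n" and RU: "R * U = 1\<^sub>m n" and k: "k \<le> n"
    and B: "B = U * mat n n (\<lambda>(i, j). if i = j \<and> k \<le> i then 1 else 0) * V"
  shows "adjugate_k k B = (det U * det V) \<cdot>\<^sub>m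
    outer_product (wedge n (map (col Z) [0..<k])) (wedge n (map (col (transpose_mat R)) [0..<k]))"
    (is "_ = _ \<cdot>\<^sub>m outer_product ?x ?y")
proof (rule eq_matI)
  have Bc: "dim_row B = n" unfolding B using U by simp
  fix a b assume "a < dim_row ((det U * det V) \<cdot>\<^sub>m outer_product ?x ?y)"
    "b < dim_col ((det U * det V) \<cdot>\<^sub>m outer_product ?x ?y)"
  then have a: "a < n choose k" and b: "b < n choose k" by (auto simp: dim_wedge)
  define S T where "S = ksubsets n k ! a" and "T = ksubsets n k ! b"
  have "S \<in> set (ksubsets n k)" "T \<in> set (ksubsets n k)"
    using a b by (auto simp: S_def T_def length_ksubsets)
  then have S: "S \<subseteq> {..<n}" "card S = k" and T: "T \<subseteq> {..<n}" "card T = k"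
    by (auto simp: set_ksubsets)
  have fin: "finite S" "finite T" using S T finite_subset by blast+
  let ?Sc = "{..<n} - S" and ?Tc = "{..<n} - T" and ?K = "{k..<n}"
  let ?e = "\<lambda>S. (-1 :: 'a) ^ (\<Sum>S + \<Sum>{..<k})"
  have cc: "card ?Sc = n - k" "card ?Tc = n - k" using S T fin by (auto simp: card_Diff_subset)
  have K: "?K \<subseteq> {..<n}" by auto
  have Tcn: "?Tc \<subseteq> {..<n}" and Scn: "?Sc \<subseteq> {..<n}" by auto
  have Uc: "submatrix U ?Tc ?K \<in> carrier_mat (n - k) (n - k)"
    and Vc: "submatrix V ?K ?Sc \<in> carrier_mat (n - k) (n - k)"
    using submatrix_carrier_mat[of ?Tc U ?K] submatrix_carrier_mat[of ?K V ?Sc] U V K by (auto simp: cc)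
  have "det (submatrix B ?Tc ?Sc) = det (submatrix U ?Tc ?K) * det (submatrix V ?K ?Sc)"
    unfolding submatrix_factorization[OF U V k B Tcn Scn] by (rule det_mult[OF Uc Vc])
  also have "det (submatrix V ?K ?Sc) = ?e S * det V * det (submatrix Z S {..<k})"
    by (rule det_complementary_minor[OF V Z VZ S])
  \<comment> \<open>Jacobi's identity is stated for bottom rows; transposing turns the last columns
    of \<open>U\<close> into such rows.\<close>
  also have "det (submatrix U ?Tc ?K) = det (submatrix (transpose_mat U) ?K ?Tc)"
    using det_transpose[OF Uc] submatrix_transpose[of ?Tc U ?K] U K by auto
  also have "\<dots> = ?e T * det (transpose_mat U) * det (submatrix (transpose_mat R) T {..<k})"
    using U R RU transpose_mult[OF R U] T by (intro det_complementary_minor) auto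
  also have "det (transpose_mat U) = det U" by (rule det_transpose[OF U])
  finally have minor: "det (submatrix B ?Tc ?Sc) = ?e T * det U * ?y $ b * (?e S * det V * ?x $ a)"
    using wedge_cols_index[OF Z k a] wedge_cols_index[of "transpose_mat R" n k b] R k b
    by (simp add: S_def T_def)
  \<comment> \<open>Both sets have \<open>k\<close> elements, so counting from 1 adds
    \<open>k\<close> to each sum.\<close>
  have sum_Suc: "(\<Sum>i\<in>S. Suc i) = \<Sum>S + k" "(\<Sum>i\<in>T. Suc i) = \<Sum>T + k"
    unfolding Suc_eq_plus1 sum.distrib using S T by simp_all
  have "adjugate_k k B $$ (a, b) =
      (-1) ^ ((\<Sum>i\<in>S. Suc i) + (\<Sum>j\<in>T. Suc j)) * det (submatrix B ?Tc ?Sc)"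
    using a b Bc by (simp add: adjugate_k_def S_def T_def Let_def)
  also have "\<dots> = ((-1) ^ (\<Sum>S + k + (\<Sum>T + k)) * ?e T * ?e S) * (det U * det V * (?x $ a * ?y $ b))"
    unfolding sum_Suc minor by (simp only: mult_ac)
  \<comment> \<open>In the collected exponent every term occurs twice.\<close>
  also have "(-1) ^ (\<Sum>S + k + (\<Sum>T + k)) * ?e T * ?e S = (1 :: 'a)"
  proof -
    have "(-1) ^ (\<Sum>S + k + (\<Sum>T + k)) * ?e T * ?e S = (-1 :: 'a) ^ (2 * (\<Sum>S + k + \<Sum>T + \<Sum>{..<k}))"
      unfolding power_add[symmetric] by (rule arg_cong[of _ _ "power (-1)"]) simp
    then show ?thesis by (simp add: power_mult)
  qed
  finally show "adjugate_k k B $$ (a, b) = ((det U * det V) \<cdot>\<^sub>m outer_product ?x ?y) $$ (a, b)"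
    using a b by (simp add: index_outer_product dim_wedge)
next
  have Bc: "dim_row B = n" unfolding B using U by simp
  show "dim_row (adjugate_k k B) = dim_row ((det U * det V) \<cdot>\<^sub>m outer_product ?x ?y)"
    "dim_col (adjugate_k k B) = dim_col ((det U * det V) \<cdot>\<^sub>m outer_product ?x ?y)"
    using Bc by (auto simp: adjugate_k_def dim_wedge Let_def)
qed

text \<open>The coordinates are the \<open>k\<close>-minors on the first \<open>k\<close> columns of
  \<open>Z\<close>; if all vanished, repeated Laplace expansion would give
  \<open>det Z = 0\<close>.\<close>

lemma wedge_cols_nonzero:
  fixes Z :: "'a :: comm_ring_1 mat"
  assumes Z: "Z \<in> carrier_mat n n" "det Z \<noteq> 0" and k: "k \<le> n"
  obtains a where "a < n choose k" "wedge n (map (col Z) [0..<k]) $ a \<noteq> 0"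
proof -
  obtain S where S: "S \<subseteq> {..<n}" "card S = k" "det (submatrix Z S {..<k}) \<noteq> 0"
    using exists_nonzero_minor[OF Z k] by blast
  then have "S \<in> set (ksubsets n k)" by (simp add: set_ksubsets)
  then obtain a where "a < n choose k" "ksubsets n k ! a = S"
    by (auto simp: in_set_conv_nth length_ksubsets)
  then show ?thesis using that[of a] wedge_cols_index[OF Z(1) k] S(3) by simp
qed

section \<open>Multiplicity of the eigenvalue\<close>

text \<open>Up to the sign \<open>(-1) ^ n\<close> this is the monic polynomial
  \<open>char_poly A\<close>.\<close>

lemma det_char_poly_nonzero:
  fixes A :: "'a :: idom mat"
  assumes A: "A \<in> carrier_mat n n"
  shows "det_char_poly A \<noteq> 0"
proof -
  have "map_mat (\<lambda>a. [:a:]) A - [:0, 1:] \<cdot>\<^sub>m 1\<^sub>m n = (-1) \<cdot>\<^sub>m char_poly_matrix A"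
    using A unfolding char_poly_matrix_def by (intro eq_matI) (auto simp: one_pCons)
  then have "det_char_poly A = (-1) ^ n * char_poly A"
    using A carrier_matD(2)[OF char_poly_matrix_closed[OF A]] by (simp add: det_char_poly_def char_poly_def)
  moreover have "char_poly A \<noteq> 0" using degree_monic_char_poly[OF A] by auto
  ultimately show ?thesis by simp
qed

text \<open>This bounds the algebraic multiplicity below by the number of independent eigenvectors.
  Over the polynomial ring, \<open>A - t I\<close> times \<open>Z\<close> has a factor
  \<open>t - \<mu>\<close> in each of its first \<open>k\<close> columns, and \<open>D\<close>
  collects these factors. Determinants then give the claim, as \<open>det Z\<close> is a nonzero
  constant.\<close>

lemma power_dvd_det_char_poly:
  fixes A Z :: "'a :: field mat"
  assumes A: "A \<in> carrier_mat n n" and Z: "Z \<in> carrier_mat n n" and dZ: "det Z \<noteq> 0" and k: "k \<le> n"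
    and eig: "\<And>i j. i < n \<Longrightarrow> j < k \<Longrightarrow> (A * Z) $$ (i, j) = \<mu> * Z $$ (i, j)"
  shows "[:- \<mu>, 1:] ^ k dvd det_char_poly A"
proof -
  let ?c = "\<lambda>a :: 'a. [:a:]"
  interpret c: comm_ring_hom ?c by unfold_locales (auto simp: one_pCons)
  define M where "M = map_mat ?c A - [:0, 1:] \<cdot>\<^sub>m 1\<^sub>m n"
  define D where "D = mat n n (\<lambda>(i, j). if i = j then if j < k then [:- \<mu>, 1:] else 1 else 0)"
  \<comment> \<open>The minus sign comes from
    \<open>(\<mu> - t) z = (t - \<mu>) (- z)\<close>.\<close>
  define W where "W = mat n n (\<lambda>(i, j). if j < k then [:- Z $$ (i, j):] else (M * map_mat ?c Z) $$ (i, j))"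
  have M: "M \<in> carrier_mat n n" and D: "D \<in> carrier_mat n n" and W: "W \<in> carrier_mat n n"
    using A by (auto simp: M_def D_def W_def)
  have MZ: "M * map_mat ?c Z = map_mat ?c (A * Z) - [:0, 1:] \<cdot>\<^sub>m map_mat ?c Z"
    using A Z unfolding M_def by (subst minus_mult_distrib_mat[of _ n n _ _ n]) (auto simp: c.mat_hom_mult)
  have "M * map_mat ?c Z = W * D"
  proof (rule eq_matI)
    fix i j assume "i < dim_row (W * D)" "j < dim_col (W * D)"
    then have i: "i < n" and j: "j < n" using W D by auto
    have "(W * D) $$ (i, j) = (\<Sum>l = 0..<n. W $$ (i, l) * D $$ (l, j))"
      using index_mult_mat_sum[OF W D i j] .
    also have "\<dots> = (\<Sum>l = 0..<n. if l = j then W $$ (i, j) * D $$ (j, j) else 0)"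
      using j by (intro sum.cong) (auto simp: D_def)
    also have "\<dots> = W $$ (i, j) * D $$ (j, j)" using j by simp
    also have "\<dots> = (M * map_mat ?c Z) $$ (i, j)"
    proof (cases "j < k")
      case True
      have "(M * map_mat ?c Z) $$ (i, j) = [:\<mu> * Z $$ (i, j):] - [:0, 1:] * [:Z $$ (i, j):]"
        unfolding MZ using i j True eig[OF i True] A Z by simp
      then show ?thesis using True i j by (simp add: W_def D_def)
    qed (use i j in \<open>simp add: W_def D_def\<close>)
    finally show "(M * map_mat ?c Z) $$ (i, j) = (W * D) $$ (i, j)" by simp
  qed (use M Z W D in auto)
  then have "det M * det (map_mat ?c Z) = det W * det D"
    using det_mult[OF M, of "map_mat ?c Z"] det_mult[OF W D] Z by simp
  also have "det D = (\<Prod>i = 0..<n. if i < k then [:- \<mu>, 1:] else 1)"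
    using D det_upper_triangular[of D n] by (simp add: prod_list_diag_prod D_def upper_triangular_def)
  also have "\<dots> = [:- \<mu>, 1:] ^ k"
  proof -
    have "(\<Prod>i = 0..<n. if i < k then [:- \<mu>, 1:] else 1) = (\<Prod>i = 0..<k. [:- \<mu>, 1:])"
      using k by (intro prod.mono_neutral_cong_right) auto
    then show ?thesis by simp
  qed
  also have "det (map_mat ?c Z) = [:det Z:]" by (rule c.hom_det)
  also have "det M = det_char_poly A" using A by (simp add: det_char_poly_def M_def)
  finally have "[:- \<mu>, 1:] ^ k dvd Polynomial.smult (det Z) (det_char_poly A)"
    by (simp add: mult.commute)
  then show ?thesis using dZ by (simp add: dvd_smult_iff)
qed

text \<open>In characteristic 0 each derivative lowers a positive order of vanishing by exactly one.
  After \<open>k\<close> of them the order is \<open>order a p - k\<close>, and the value at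
  \<open>a\<close> is nonzero iff that is 0.\<close>

lemma poly_higher_pderiv_nonzero_iff:
  fixes p :: "'a :: field_char_0 poly"
  assumes "p \<noteq> 0" "k \<le> Polynomial.order a p"
  shows "poly ((pderiv ^^ k) p) a \<noteq> 0 \<longleftrightarrow> Polynomial.order a p = k"
  using assms
proof (induction k arbitrary: p)
  case 0
  then show ?case by (simp add: order_root)
next
  case (Suc k)
  then have root: "poly p a = 0" by (simp add: order_root)
  \<comment> \<open>In characteristic 0 a zero derivative means a constant, and a constant with a
    root is zero.\<close>
  have "pderiv p \<noteq> 0"
  proof
    assume "pderiv p = 0"
    then obtain c where "p = [:c:]" by (auto simp: pderiv_eq_0_iff elim: degree_eq_zeroE)
    then show False using root Suc.prems(1) by simp
  qed
  then show ?case
    using Suc.IH[of "pderiv p"] Suc.prems order_pderiv[OF Suc.prems(1) root]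
    by (simp add: funpow_swap1)
qed

section \<open>Wedges of kernel vectors and the equivalence\<close>

lemma wedge_smult_in_ext_power:
  fixes xs :: "'a :: field vec list"
  assumes "length xs = k" "set xs \<subseteq> W"
  shows "c \<cdot>\<^sub>v wedge n xs \<in> ext_power n k W"
proof -
  interpret vec_space "TYPE('a)" "n choose k" .
  let ?G = "{wedge n xs | xs. length xs = k \<and> set xs \<subseteq> W}"
  have G: "?G \<subseteq> carrier_vec (n choose k)" by (auto simp: wedge_def)
  have "wedge n xs \<in> span ?G" using in_own_span[of ?G] G assms by auto
  then show ?thesis unfolding ext_power_def using G by (intro smult_in_span) auto
qed

text \<open>The first \<open>k\<close> columns of the right-hand side of \<open>eq\<close> vanish.
  This serves both \<open>B\<close> with \<open>Z\<close> and the transpose of \<open>B\<close> with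
  the transposed inverse of \<open>U\<close>.\<close>

lemma col_in_mat_kernel:
  fixes B U Z :: "'a :: comm_ring_1 mat"
  assumes "B \<in> carrier_mat n n" "Z \<in> carrier_mat n n" "U \<in> carrier_mat n n"
    and eq: "B * Z = U * mat n n (\<lambda>(i, j). if i = j \<and> k \<le> i then 1 else 0)"
    and "j < k" "k \<le> n"
  shows "col Z j \<in> mat_kernel B"
proof (rule mat_kernelI)
  have "B *\<^sub>v col Z j = col (B * Z) j" using assms(1,2,5,6) by (intro eq_vecI) auto
  also have "\<dots> = 0\<^sub>v n"
    unfolding eq mult_partial_identity[OF assms(3)] using assms by (intro eq_vecI) auto
  finally show "B *\<^sub>v col Z j = 0\<^sub>v n" .
qed (use assms in auto)

theorem theorem3p4:
  fixes A :: "complex mat" and \<mu> :: complex and n k :: nat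
  assumes "n \<ge> 1"
    and "A \<in> carrier_mat n n"
    and "eigenvalue A \<mu>"
    and "geometric_multiplicity A \<mu> = k"
    and "1 \<le> k" and "k \<le> n - 1"
  shows "algebraic_multiplicity A \<mu> = k \<longleftrightarrow>
    (\<exists>v \<in> ext_power n k (mat_kernel (A - \<mu> \<cdot>\<^sub>m 1\<^sub>m n)).
     \<exists>w \<in> ext_power n k (mat_kernel (transpose_mat (A - \<mu> \<cdot>\<^sub>m 1\<^sub>m n))).
       ((-1) ^ k * poly ((pderiv ^^ k) (det_char_poly A)) \<mu> / fact k) \<cdot>\<^sub>m outer_product v w
         = adjugate_k k (A - \<mu> \<cdot>\<^sub>m 1\<^sub>m n))"
proof -
  note A = assms(2)
  define B where "B = A - \<mu> \<cdot>\<^sub>m 1\<^sub>m n"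
  let ?J = "mat n n (\<lambda>(i, j). if i = j \<and> k \<le> i then 1 else 0 :: complex)"
  have B: "B \<in> carrier_mat n n" unfolding B_def by (intro minus_carrier_mat) auto
  have kd: "kernel_dim B = k" using assms(4) A by (simp add: geometric_multiplicity_def B_def)
  obtain U Z where U: "U \<in> carrier_mat n n" "det U \<noteq> 0" and Z: "Z \<in> carrier_mat n n" "det Z \<noteq> 0"
    and k: "k \<le> n" and BZ: "B * Z = U * ?J"
    by (rule kernel_dim_factorization[OF B kd])
  obtain R where R: "R \<in> carrier_mat n n" and RU: "R * U = 1\<^sub>m n"
    by (rule det_nonzero_obtain_inverse[OF U])
  obtain V where V: "V \<in> carrier_mat n n" and ZV: "Z * V = 1\<^sub>m n" and VZ: "V * Z = 1\<^sub>m n"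
    by (rule det_nonzero_obtain_inverse[OF Z])
  have dV: "det V \<noteq> 0" and dR: "det (transpose_mat R) \<noteq> 0"
    using det_mult[OF Z(1) V] det_mult[OF R U(1)] det_transpose[OF R] by (auto simp: ZV RU)
  have J: "?J \<in> carrier_mat n n" "transpose_mat ?J = ?J" by auto
  have "B = B * (Z * V)" unfolding ZV using B by simp
  also have "\<dots> = U * ?J * V" using assoc_mult_mat[OF B Z(1) V] BZ by simp
  finally have fact: "B = U * ?J * V" .
  define xs ys where "xs = map (col Z) [0..<k]" and "ys = map (col (transpose_mat R)) [0..<k]"
  define d where "d = det U * det V"
  have d: "d \<noteq> 0" using U dV by (simp add: d_def)
  have adj: "adjugate_k k B = d \<cdot>\<^sub>m outer_product (wedge n xs) (wedge n ys)"
    unfolding d_def xs_def ys_def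
    by (rule adjugate_k_eq_outer_product[OF U(1) V Z(1) R VZ RU k fact])
  have xs: "length xs = k" "set xs \<subseteq> mat_kernel B"
    using col_in_mat_kernel[OF B Z(1) U(1) BZ _ k] by (auto simp: xs_def)
  \<comment> \<open>From \<open>R * U = 1\<close> one gets \<open>R * B = J * V\<close> with
    \<open>J\<close> the partial identity. As \<open>J\<close> is symmetric, transposing gives the
    shape that \<open>col_in_mat_kernel\<close> expects, with the transpose of \<open>V\<close> in
    the role of \<open>U\<close>.\<close>
  have "transpose_mat B * transpose_mat R = transpose_mat (R * B)"
    by (rule transpose_mult[OF R B, symmetric])
  also have "R * B = (R * U) * (?J * V)"
  proof -
    have JV: "?J * V \<in> carrier_mat n n" using J(1) V by (rule mult_carrier_mat)
    show ?thesis
      unfolding fact assoc_mult_mat[OF U(1) J(1) V] by (rule assoc_mult_mat[OF R U(1) JV, symmetric])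
  qed
  also have "\<dots> = ?J * V" unfolding RU using V J(1) by simp
  also have "transpose_mat (?J * V) = transpose_mat V * ?J"
    unfolding transpose_mult[OF J(1) V] J(2) ..
  finally have "col (transpose_mat R) j \<in> mat_kernel (transpose_mat B)" if "j < k" for j
    using col_in_mat_kernel[of "transpose_mat B" n "transpose_mat R" "transpose_mat V"] B R V that k
    by auto
  then have ys: "length ys = k" "set ys \<subseteq> mat_kernel (transpose_mat B)"
    by (auto simp: ys_def)
  let ?P = "det_char_poly A"
  define c where "c = (-1) ^ k * poly ((pderiv ^^ k) ?P) \<mu> / fact k"
  \<comment> \<open>The first \<open>k\<close> columns of \<open>Z\<close> lie in the kernel of
    \<open>B\<close>, so they are eigenvectors. The resulting bound on the order of the root lets
    the \<open>k\<close>th derivative decide whether that order is exactly \<open>k\<close>.\<close>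
  have "(A * Z) $$ (i, j) = \<mu> * Z $$ (i, j)" if "i < n" "j < k" for i j
  proof -
    have "A * Z = B * Z + \<mu> \<cdot>\<^sub>m Z"
    proof -
      have "B * Z = A * Z - \<mu> \<cdot>\<^sub>m Z"
        unfolding B_def using A Z(1) by (subst minus_mult_distrib_mat[of _ n n _ _ n]) auto
      then show ?thesis using A Z(1) by (intro eq_matI) auto
    qed
    then show ?thesis unfolding BZ mult_partial_identity[OF U(1)] using that k Z(1) by simp
  qed
  then have "[:- \<mu>, 1:] ^ k dvd ?P" by (rule power_dvd_det_char_poly[OF A Z k])
  moreover have P: "?P \<noteq> 0" by (rule det_char_poly_nonzero[OF A])
  ultimately have "k \<le> Polynomial.order \<mu> ?P" by (simp add: order_divides)
  then have "poly ((pderiv ^^ k) ?P) \<mu> \<noteq> 0 \<longleftrightarrow> algebraic_multiplicity A \<mu> = k"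
    unfolding algebraic_multiplicity_def by (rule poly_higher_pderiv_nonzero_iff[OF P])
  then have c: "algebraic_multiplicity A \<mu> = k \<longleftrightarrow> c \<noteq> 0" by (simp add: c_def)
  also have "c \<noteq> 0 \<longleftrightarrow> (\<exists>v \<in> ext_power n k (mat_kernel B).
     \<exists>w \<in> ext_power n k (mat_kernel (transpose_mat B)). c \<cdot>\<^sub>m outer_product v w = adjugate_k k B)"
  proof
    assume c: "c \<noteq> 0"
    \<comment> \<open>The factor \<open>d / c\<close> turns the prescribed scalar \<open>c\<close>
      into the \<open>d\<close> of \<open>adj\<close>.\<close>
    have "(d / c) \<cdot>\<^sub>v wedge n xs \<in> ext_power n k (mat_kernel B)"
      using xs by (rule wedge_smult_in_ext_power)
    moreover have "wedge n ys \<in> ext_power n k (mat_kernel (transpose_mat B))"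
      using wedge_smult_in_ext_power[OF ys, of 1 n] by simp
    moreover have "c \<cdot>\<^sub>m outer_product ((d / c) \<cdot>\<^sub>v wedge n xs) (wedge n ys) = adjugate_k k B"
      unfolding adj using c by (intro eq_matI) (auto simp: index_outer_product)
    ultimately show "\<exists>v \<in> ext_power n k (mat_kernel B).
      \<exists>w \<in> ext_power n k (mat_kernel (transpose_mat B)). c \<cdot>\<^sub>m outer_product v w = adjugate_k k B"
      by blast
  next
    assume "\<exists>v \<in> ext_power n k (mat_kernel B).
      \<exists>w \<in> ext_power n k (mat_kernel (transpose_mat B)). c \<cdot>\<^sub>m outer_product v w = adjugate_k k B"
    then obtain v w where vw: "c \<cdot>\<^sub>m outer_product v w = adjugate_k k B" by blast
    \<comment> \<open>At a pair of coordinates where both wedges are nonzero, the adjugate has a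
      nonzero entry, which \<open>c = 0\<close> would contradict.\<close>
    obtain a where a: "a < n choose k" "wedge n xs $ a \<noteq> 0"
      unfolding xs_def using wedge_cols_nonzero[OF Z k] .
    obtain b where b: "b < n choose k" "wedge n ys $ b \<noteq> 0"
      unfolding ys_def using wedge_cols_nonzero[OF _ dR k] R by auto
    have "adjugate_k k B $$ (a, b) \<noteq> 0"
      unfolding adj using a b d xs(1) ys(1) by (simp add: index_outer_product dim_wedge)
    moreover have "a < dim_row (adjugate_k k B)" "b < dim_col (adjugate_k k B)"
      unfolding adj using a b xs(1) ys(1) by (simp_all add: dim_wedge)
    ultimately show "c \<noteq> 0" unfolding vw[symmetric] by auto
  qed
  finally show ?thesis unfolding B_def c_def .
qed

end
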